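(* Consider the function $$Q_0^{(n)}(\bar\sigma_j^2,\theta)=-N\log(\bar\sigma_j^2)-\frac1{\bar\sigma_j^2}\Big[w_j^\top w_j-2w_j^\top\mathbf W_{ji}\mathbf g_{ji}+\mathbf g_{ji}^\top\mathbf W_{ji}^\top\mathbf W_{ji}\mathbf g_{ji}-2w_j^\top\mathbf W\hat{\mathbf m}^{(n)}+2\mathbf g_{ji}^\top\mathbf W_{ji}^\top\mathbf W\hat{\mathbf m}^{(n)}+\mathrm{tr}\big(\mathbf W^\top\mathbf W\hat{\mathbf M}^{(n)}\big)\Big],$$ where $\mathbf g_{ji}$ and $\mathbf W$ depend on $\theta$. Let $\hat\theta^{(n+1)}$ be the updated estimate of $\theta$ (the maximizer of $Q_0^{(n)}$ with respect to $\theta$), and let $\hat{\mathbf g}_{ji}^{(n+1)}$, $\hat{\mathbf W}^{(n+1)}$ be constructed by inserting $\hat\theta^{(n+1)}$ in the general expressions of $\mathbf g_{ji}$ and $\mathbf W$. Then the update of the noise variance, i.e. the maximizer of $\bar\sigma_j^2\mapsto Q_0^{(n)}(\bar\sigma_j^2,\hat\theta^{(n+1)})$ over $\bar\sigma_j^2>0$, is (provided the right-hand side is positive) $$(\hat{\bar\sigma}_j^2)^{(n+1)}=\frac1N\Big[\|w_j-\mathbf W_{ji}\hat{\mathbf g}_{ji}^{(n+1)}\|_2^2-2w_j^\top\hat{\mathbf W}^{(n+1)}\hat{\mathbf m}^{(n)}+2\hat{\mathbf g}_{ji}^{(n+1)\top}\mathbf W_{ji}^\top\hat{\mathbf W}^{(n+1)}\hat{\mathbf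 m}^{(n)}+\mathrm{tr}\big(\hat{\mathbf W}^{(n+1)\top}\hat{\mathbf W}^{(n+1)}\hat{\mathbf M}^{(n)}\big)\Big].$$
   Context: $N,l$ are positive integers. $j$ is the output node, $\mathcal N_j\not\ni j$ is a finite set of input node indices, $i\in\mathcal N_j$, and $\mathcal N_j\setminus\{i\}=\{k_1,\dots,k_p\}$. Measured signals $w_k(t)$, $t=1,\dots,N$, are given; $w_j=[w_j(1)\ \dots\ w_j(N)]^\top$. For $x\in\mathbb R^N$ the $N\times r$ Toeplitz matrix of $x$ has $(s,t)$ entry $x_{s-t+1}$ if $s\ge t$ and $0$ otherwise. $W_k$ is the $N\times l$ Toeplitz matrix of $[0\ w_k(1)\ \dots\ w_k(N-1)]^\top$ for $k\in(\mathcal N_j\cup\{j\})\setminus\{i\}$; $W_\ell^N$ is the $N\times N$ Toeplitz matrix of $[0\ w_\ell(1)\ \dots\ w_\ell(N-1)]^\top$ and $\overleftrightarrow W_\ell$ the $N\times l$ Toeplitz matrix of $[0\ 0\ -w_\ell(1)\ \dots\ -w_\ell(N-2)]^\top$, $\ell\in\{i,j\}$. For $\theta=[\theta_B^\top\ \theta_F^\top]^\top$ (coefficients of numerator and of denominator-minus-one of the target module $G_{ji}$, each of length at most $N$) put $b_{ji}=[\theta_B^\top\ 0^\top]^\top$, $f_{ji}=[\theta_F^\top\ 0^\top]^\top\in\mathbb R^N$, $\mathbf g_{ji}=[b_{ji}^\top\ f_{ji}^\top]^\top$, let $G_b,G_f$ be the $N\times N$ Toeplitz matrices of $b_{ji},f_{ji}$,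 and $\tilde W=W_j+G_b\overleftrightarrow W_i-G_f\overleftrightarrow W_j$, $\mathbf W_{ji}=[W_i^N\ \ -W_j^N]$, $\mathbf W=[\tilde W\ W_{k_1}\ \dots\ W_{k_p}]$. Kernel: $K_\beta\in\mathbb R^{l\times l}$, $[K_\beta]_{x,y}=\beta^{\max(x,y)}$. The model is $w_j=\mathbf W\mathbf m+\mathbf W_{ji}\mathbf g_{ji}+\bar e_j$, $\mathbf m=[m_j^\top\ m_{k_1}^\top\dots m_{k_p}^\top]^\top\sim\mathcal N(0,\mathbf K)$, $\mathbf K=\mathrm{diag}\{\lambda_jK_{\beta_j},\lambda_{k_1}K_{\beta_{k_1}},\dots,\lambda_{k_p}K_{\beta_{k_p}}\}$, $\bar e_j\sim\mathcal N(0,\bar\sigma_j^2I_N)$ independent of $\mathbf m$ (with $\mathbf W,\mathbf W_{ji}$ treated as given matrices), and $\eta$ collects $\theta$, all $\lambda$'s, all $\beta$'s and $\bar\sigma_j^2$ (with $\lambda$'s and $\bar\sigma_j^2$ positive and $\beta$'s in $(0,1)$). The posterior of $\mathbf m$ given $w_j$ is Gaussian with covariance $\mathbf P_m=(\mathbf W^\top\mathbf W/\bar\sigma_j^2+\mathbf K^{-1})^{-1}$ and mean $\mathbf P_m\mathbf W^\top(w_j-\mathbf W_{ji}\mathbf g_{ji})/\bar\sigma_j^2$. For a current estimate $\hat\eta^{(n)}$, let $\hat{\mathbf P}_m^{(n)}$ and $\hat{\mathbf m}^{(n)}$ be this covariance and mean evaluated at $\eta=\hat\eta^{(n)}$, and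 $\hat{\mathbf M}^{(n)}=\hat{\mathbf P}_m^{(n)}+\hat{\mathbf m}^{(n)}\hat{\mathbf m}^{(n)\top}$. These are fixed during the update. *)

theory Defs
  imports
    "HOL-Analysis.L2_Norm"
    "Jordan_Normal_Form.Gauss_Jordan_Elimination"
begin

text \<open>
  Vectors and matrices have their dimensions as explicit carriers. Their entries are indexed
  from 0, whereas times \<open>t = 1, \<dots>, N\<close> index the signals \<open>w k :: nat \<Rightarrow> real\<close>; entry
  \<open>t\<close> of a vector of length \<open>N\<close> therefore belongs to time \<open>t + 1\<close>.
\<close>

definition hcat :: "nat \<Rightarrow> real mat list \<Rightarrow> real mat" where
  "hcat n Ms = mat_of_cols n (concat (map cols Ms))"

definition mat_inv :: "real mat \<Rightarrow> real mat" where
  "mat_inv A = the (mat_inverse A)"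

definition mat_trace :: "real mat \<Rightarrow> real" where
  "mat_trace A = sum_list (diag_mat A)"

definition vec_norm2 :: "real vec \<Rightarrow> real" where
  "vec_norm2 v = L2_set (\<lambda>t. v $ t) {..<dim_vec v}"

definition outer :: "real vec \<Rightarrow> real vec \<Rightarrow> real mat" where
  "outer u v = mat (dim_vec u) (dim_vec v) (\<lambda>(a, b). u $ a * v $ b)"

definition toeplitz :: "nat \<Rightarrow> real vec \<Rightarrow> real mat" where
  "toeplitz r x = mat (dim_vec x) r (\<lambda>(s, t). if t \<le> s then x $ (s - t) else 0)"


definition sig_vec :: "nat \<Rightarrow> (nat \<Rightarrow> real) \<Rightarrow> real vec" where
  "sig_vec N u = vec N (\<lambda>t. u (t + 1))"

text \<open>\<open>[0 u(1) \<dots> u(N-1)]\<close> and \<open>[0 0 -u(1) \<dots> -u(N-2)]\<close>, truncated to length \<open>N\<close>:\<close>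

definition delay_vec :: "nat \<Rightarrow> (nat \<Rightarrow> real) \<Rightarrow> real vec" where
  "delay_vec N u = vec N (\<lambda>t. if t < 1 then 0 else u t)"

definition neg_delay2_vec :: "nat \<Rightarrow> (nat \<Rightarrow> real) \<Rightarrow> real vec" where
  "neg_delay2_vec N u = vec N (\<lambda>t. if t < 2 then 0 else - u (t - 1))"


text \<open>\<open>\<theta>\<close> stacks the \<open>nB\<close> numerator coefficients on top of the \<open>nF\<close> denominator coefficients.\<close>

definition b_vec :: "nat \<Rightarrow> nat \<Rightarrow> real vec \<Rightarrow> real vec" where
  "b_vec N nB \<theta> = vec_first \<theta> nB @\<^sub>v 0\<^sub>v (N - nB)"

definition f_vec :: "nat \<Rightarrow> nat \<Rightarrow> real vec \<Rightarrow> real vec" where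
  "f_vec N nF \<theta> = vec_last \<theta> nF @\<^sub>v 0\<^sub>v (N - nF)"

definition g_vec :: "nat \<Rightarrow> nat \<Rightarrow> nat \<Rightarrow> real vec \<Rightarrow> real vec" where
  "g_vec N nB nF \<theta> = b_vec N nB \<theta> @\<^sub>v f_vec N nF \<theta>"

definition Wji_mat :: "nat \<Rightarrow> nat \<Rightarrow> nat \<Rightarrow> (nat \<Rightarrow> nat \<Rightarrow> real) \<Rightarrow> real mat" where
  "Wji_mat N i j w =
     hcat N [toeplitz N (delay_vec N (w i)), - toeplitz N (delay_vec N (w j))]"

definition Wtilde_mat ::
  "nat \<Rightarrow> nat \<Rightarrow> nat \<Rightarrow> nat \<Rightarrow> nat \<Rightarrow> nat \<Rightarrow> (nat \<Rightarrow> nat \<Rightarrow> real) \<Rightarrow> real vec \<Rightarrow> real mat"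
where
  "Wtilde_mat N l nB nF i j w \<theta> =
     toeplitz l (delay_vec N (w j))
     + toeplitz N (b_vec N nB \<theta>) * toeplitz l (neg_delay2_vec N (w i))
     - toeplitz N (f_vec N nF \<theta>) * toeplitz l (neg_delay2_vec N (w j))"

text \<open>\<open>ks\<close> enumerates the input nodes other than \<open>i\<close>.\<close>

definition W_mat ::
  "nat \<Rightarrow> nat \<Rightarrow> nat \<Rightarrow> nat \<Rightarrow> nat \<Rightarrow> nat \<Rightarrow> nat list \<Rightarrow> (nat \<Rightarrow> nat \<Rightarrow> real) \<Rightarrow> real vec
     \<Rightarrow> real mat"
where
  "W_mat N l nB nF i j ks w \<theta> =
     hcat N (Wtilde_mat N l nB nF i j w \<theta> # map (\<lambda>k. toeplitz l (delay_vec N (w k))) ks)"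


text \<open>Only the values of \<open>hp_lambda\<close> and \<open>hp_beta\<close> at the nodes \<open>j, k\<^sub>1, \<dots>, k\<^sub>p\<close> matter.\<close>

record hyperparam =
  hp_theta :: "real vec"
  hp_lambda :: "nat \<Rightarrow> real"
  hp_beta :: "nat \<Rightarrow> real"
  hp_sigma2 :: real

text \<open>The exponent is \<open>max(x, y)\<close> for the 1-based row and column numbers.\<close>

definition kernel_mat :: "nat \<Rightarrow> real \<Rightarrow> real mat" where
  "kernel_mat l \<beta> = mat l l (\<lambda>(x, y). \<beta> ^ max (x + 1) (y + 1))"

definition prior_cov :: "nat \<Rightarrow> nat \<Rightarrow> nat list \<Rightarrow> hyperparam \<Rightarrow> real mat" where
  "prior_cov l j ks \<eta> =
     diag_block_mat (map (\<lambda>k. hp_lambda \<eta> k \<cdot>\<^sub>m kernel_mat l (hp_beta \<eta> k)) (j # ks))"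

text \<open>
  Covariance and mean of the Gaussian posterior of \<open>m\<close> given \<open>w\<^sub>j\<close>. The matrices inverted are
  positive definite for positive \<open>\<lambda>\<close>s and \<open>\<sigma>\<^sup>2\<close> and for \<open>\<beta>\<close>s in \<open>(0, 1)\<close>.
\<close>

definition post_cov ::
  "nat \<Rightarrow> nat \<Rightarrow> nat \<Rightarrow> nat \<Rightarrow> nat \<Rightarrow> nat \<Rightarrow> nat list \<Rightarrow> (nat \<Rightarrow> nat \<Rightarrow> real) \<Rightarrow> hyperparam
     \<Rightarrow> real mat"
where
  "post_cov N l nB nF i j ks w \<eta> =
     (let W = W_mat N l nB nF i j ks w (hp_theta \<eta>)
      in mat_inv ((1 / hp_sigma2 \<eta>) \<cdot>\<^sub>m (W\<^sup>T * W) + mat_inv (prior_cov l j ks \<eta>)))"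

definition post_mean ::
  "nat \<Rightarrow> nat \<Rightarrow> nat \<Rightarrow> nat \<Rightarrow> nat \<Rightarrow> nat \<Rightarrow> nat list \<Rightarrow> (nat \<Rightarrow> nat \<Rightarrow> real) \<Rightarrow> hyperparam
     \<Rightarrow> real vec"
where
  "post_mean N l nB nF i j ks w \<eta> =
     (let W = W_mat N l nB nF i j ks w (hp_theta \<eta>);
          r = sig_vec N (w j) - Wji_mat N i j w *\<^sub>v g_vec N nB nF (hp_theta \<eta>)
      in (1 / hp_sigma2 \<eta>) \<cdot>\<^sub>v (post_cov N l nB nF i j ks w \<eta> *\<^sub>v (W\<^sup>T *\<^sub>v r)))"

definition post_second_moment ::
  "nat \<Rightarrow> nat \<Rightarrow> nat \<Rightarrow> nat \<Rightarrow> nat \<Rightarrow> nat \<Rightarrow> nat list \<Rightarrow> (nat \<Rightarrow> nat \<Rightarrow> real) \<Rightarrow> hyperparam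
     \<Rightarrow> real mat"
where
  "post_second_moment N l nB nF i j ks w \<eta> =
     (let m = post_mean N l nB nF i j ks w \<eta>
      in post_cov N l nB nF i j ks w \<eta> + outer m m)"


text \<open>\<open>\<eta>n\<close> is the current estimate, \<open>s\<close> the noise variance:\<close>

definition Q0 ::
  "nat \<Rightarrow> nat \<Rightarrow> nat \<Rightarrow> nat \<Rightarrow> nat \<Rightarrow> nat \<Rightarrow> nat list \<Rightarrow> (nat \<Rightarrow> nat \<Rightarrow> real) \<Rightarrow> hyperparam
     \<Rightarrow> real \<Rightarrow> real vec \<Rightarrow> real"
where
  "Q0 N l nB nF i j ks w \<eta>n s \<theta> =
     (let wj = sig_vec N (w j);
          Wji = Wji_mat N i j w;
          g = g_vec N nB nF \<theta>;
          W = W_mat N l nB nF i j ks w \<theta>;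
          m = post_mean N l nB nF i j ks w \<eta>n;
          M = post_second_moment N l nB nF i j ks w \<eta>n
      in - real N * ln s
         - (1 / s) * (wj \<bullet> wj - 2 * (wj \<bullet> (Wji *\<^sub>v g)) + g \<bullet> (Wji\<^sup>T *\<^sub>v (Wji *\<^sub>v g))
                      - 2 * (wj \<bullet> (W *\<^sub>v m)) + 2 * (g \<bullet> (Wji\<^sup>T *\<^sub>v (W *\<^sub>v m)))
                      + mat_trace (W\<^sup>T * W * M)))"

end

theory Submission
  imports Defs
begin

text \<open>
  Expanding the square turns \<open>Q\<^sub>0(s, \<theta>')\<close> into \<open>- N ln s - N v / s\<close>. With \<open>x = v / s\<close>, its value at
  \<open>v\<close> exceeds that at \<open>s\<close> by \<open>N (x - 1 - ln x) \<ge> 0\<close>, with equality only for \<open>x = 1\<close>.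
\<close>

lemma is_arg_max_neg_ln_minus_inverse:
  fixes n v s :: real
  assumes "0 < n" and "0 < v"
  shows "is_arg_max (\<lambda>s. - n * ln s - (1 / s) * (n * v)) (\<lambda>s. 0 < s) s \<longleftrightarrow> s = v"
proof -
  let ?f = "\<lambda>s. - n * ln s - (1 / s) * (n * v)"
  \<comment> \<open>At \<open>v\<close> the second term of \<open>?f\<close> is the constant
    \<open>- n\<close>, and the two logarithms combine into \<open>ln (v / s)\<close>.\<close>
  have gap: "?f v - ?f s = n * (v / s - 1 - ln (v / s))" if "0 < s" for s
    using that assms by (simp add: ln_div field_simps)
  have le: "?f s \<le> ?f v" if "0 < s" for s
  proof -
    have "0 \<le> n * (v / s - 1 - ln (v / s))"
      using that assms ln_le_minus_one[of "v / s"] by (intro mult_nonneg_nonneg) auto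
    with gap[OF that] show ?thesis by linarith
  qed
  have eq: "s = v" if "0 < s" "?f s = ?f v" for s
  proof -
    \<comment> \<open>A vanishing gap is the equality case of \<open>ln x \<le> x - 1\<close>, which
      occurs only at \<open>x = 1\<close>.\<close>
    have "ln (v / s) = v / s - 1"
      using gap[OF that(1)] that(2) assms(1) by simp
    then have "v / s = 1"
      using that(1) assms(2) by (intro ln_eq_minus_one) auto
    with that(1) show ?thesis by simp
  qed
  show ?thesis
  proof
    assume "is_arg_max ?f (\<lambda>s. 0 < s) s"
    \<comment> \<open>Since \<open>0 < v\<close>, the point \<open>v\<close> is itself a competitor,
      so it cannot beat a maximizer.\<close>
    then have "0 < s" and "\<not> ?f s < ?f v"
      using assms(2) unfolding is_arg_max_def by blast+
    with le[of s] show "s = v" by (intro eq) linarith+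
  next
    assume "s = v"
    with le assms(2) show "is_arg_max ?f (\<lambda>s. 0 < s) s"
      unfolding is_arg_max_def by (metis not_less)
  qed
qed

lemma vec_norm2_power2: "(vec_norm2 x)\<^sup>2 = x \<bullet> x"
  by (simp add: vec_norm2_def L2_set_def scalar_prod_def sum_nonneg power2_eq_square
      lessThan_atLeast0)

lemma vec_norm2_diff_power2:
  assumes "x \<in> carrier_vec n" and "y \<in> carrier_vec n"
  shows "(vec_norm2 (x - y))\<^sup>2 = x \<bullet> x - 2 * (x \<bullet> y) + y \<bullet> y"
proof -
  have "(x - y) \<bullet> (x - y) = (x \<bullet> x - y \<bullet> x) - (x \<bullet> y - y \<bullet> y)"
    using assms by (simp add: scalar_prod_minus_distrib[of _ n] minus_scalar_prod_distrib[of _ n])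
  then show ?thesis
    using comm_scalar_prod[OF assms] by (simp add: vec_norm2_power2)
qed

text \<open>Adjointness of \<open>A\<close> and its transpose turns the quadratic term into
  \<open>(A *\<^sub>v g) \<bullet> (A *\<^sub>v g)\<close>. The right-hand side has the shape of the
  first three terms in the bracket of \<open>Q0\<close>.\<close>

lemma vec_norm2_residual_power2:
  assumes "A \<in> carrier_mat n k" and "x \<in> carrier_vec n" and "g \<in> carrier_vec k"
  shows "(vec_norm2 (x - A *\<^sub>v g))\<^sup>2
    = x \<bullet> x - 2 * (x \<bullet> (A *\<^sub>v g)) + g \<bullet> (A\<^sup>T *\<^sub>v (A *\<^sub>v g))"
proof -
  have Ag: "A *\<^sub>v g \<in> carrier_vec n"
    using assms by simp
  \<comment> \<open>Swapping the factors puts the transpose on the left, where the adjoint rule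
    applies.\<close>
  have "g \<bullet> (A\<^sup>T *\<^sub>v (A *\<^sub>v g)) = (A\<^sup>T *\<^sub>v (A *\<^sub>v g)) \<bullet> g"
    using assms Ag by (intro comm_scalar_prod[of _ k]) auto
  also have "\<dots> = (A *\<^sub>v g) \<bullet> (A *\<^sub>v g)"
    using assms(1,3) Ag by (intro transpose_vec_mult_scalar) auto
  finally show ?thesis
    using vec_norm2_diff_power2[OF assms(2) Ag] by simp
qed

lemma Wji_mat_carrier: "Wji_mat N i j w \<in> carrier_mat N (N + N)"
  by (intro carrier_matI) (simp_all add: Wji_mat_def hcat_def toeplitz_def delay_vec_def)

text \<open>Both slices of \<open>\<theta>\<close> have lengths \<open>nB\<close> and
  \<open>nF\<close> by construction. The bounds make the truncated subtractions
  \<open>N - nB\<close> and \<open>N - nF\<close> pad each slice to length exactly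
  \<open>N\<close>.\<close>

lemma g_vec_carrier:
  assumes "nB \<le> N" and "nF \<le> N"
  shows "g_vec N nB nF \<theta> \<in> carrier_vec (N + N)"
  using assms by (intro carrier_vecI) (simp add: g_vec_def b_vec_def f_vec_def)

lemma sig_vec_carrier: "sig_vec N u \<in> carrier_vec N"
  by (simp add: sig_vec_def)

theorem theorem3:
  fixes N l nB nF i j :: nat
    and Nj :: "nat set" and ks :: "nat list"
    and w :: "nat \<Rightarrow> nat \<Rightarrow> real"
    and \<eta>n :: hyperparam
    and s0 :: real and \<theta>' :: "real vec"
  defines "wj \<equiv> sig_vec N (w j)"
    and "Wji \<equiv> Wji_mat N i j w"
    and "m \<equiv> post_mean N l nB nF i j ks w \<eta>n"
    and "M \<equiv> post_second_moment N l nB nF i j ks w \<eta>n"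
    and "g' \<equiv> g_vec N nB nF \<theta>'"
    and "W' \<equiv> W_mat N l nB nF i j ks w \<theta>'"
  defines "v \<equiv> (1 / real N) *
      ((vec_norm2 (wj - Wji *\<^sub>v g'))\<^sup>2 - 2 * (wj \<bullet> (W' *\<^sub>v m))
        + 2 * (g' \<bullet> (Wji\<^sup>T *\<^sub>v (W' *\<^sub>v m))) + mat_trace (W'\<^sup>T * W' * M))"
  assumes "0 < N" and "0 < l" and "nB \<le> N" and "nF \<le> N"
    and "finite Nj" and "j \<notin> Nj" and "i \<in> Nj"
    and "distinct ks" and "set ks = Nj - {i}"
    and "hp_theta \<eta>n \<in> carrier_vec (nB + nF)" and "0 < hp_sigma2 \<eta>n"
    and "\<And>k. k \<in> insert j (Nj - {i}) \<Longrightarrow> 0 < hp_lambda \<eta>n k"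
    and "\<And>k. k \<in> insert j (Nj - {i}) \<Longrightarrow> 0 < hp_beta \<eta>n k \<and> hp_beta \<eta>n k < 1"
    and "0 < s0"
    and "is_arg_max (\<lambda>\<theta>. Q0 N l nB nF i j ks w \<eta>n s0 \<theta>) (\<lambda>\<theta>. \<theta> \<in> carrier_vec (nB + nF)) \<theta>'"
    and "0 < v"
  shows "\<forall>s. is_arg_max (\<lambda>s. Q0 N l nB nF i j ks w \<eta>n s \<theta>') (\<lambda>s. 0 < s) s \<longleftrightarrow> s = v"
proof -
  have "(vec_norm2 (wj - Wji *\<^sub>v g'))\<^sup>2
      = wj \<bullet> wj - 2 * (wj \<bullet> (Wji *\<^sub>v g')) + g' \<bullet> (Wji\<^sup>T *\<^sub>v (Wji *\<^sub>v g'))"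
    unfolding wj_def Wji_def g'_def
    using \<open>nB \<le> N\<close> \<open>nF \<le> N\<close>
    by (intro vec_norm2_residual_power2[OF Wji_mat_carrier] sig_vec_carrier g_vec_carrier)
  \<comment> \<open>The whole bracket of \<open>Q0\<close> at \<open>\<theta>'\<close> is the one in
    \<open>v\<close> with its squared norm expanded; the factor \<open>1 / real N\<close> cancels as
    \<open>0 < N\<close>.\<close>
  then have Nv: "wj \<bullet> wj - 2 * (wj \<bullet> (Wji *\<^sub>v g')) + g' \<bullet> (Wji\<^sup>T *\<^sub>v (Wji *\<^sub>v g'))
      - 2 * (wj \<bullet> (W' *\<^sub>v m)) + 2 * (g' \<bullet> (Wji\<^sup>T *\<^sub>v (W' *\<^sub>v m))) + mat_trace (W'\<^sup>T * W' * M)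
      = real N * v"
    unfolding v_def using \<open>0 < N\<close> by simp
  \<comment> \<open>Reading \<open>Nv\<close> backwards restores the bracket in place of
    \<open>real N * v\<close>, so that unfolding definitions makes both sides identical.\<close>
  have "Q0 N l nB nF i j ks w \<eta>n s \<theta>' = - real N * ln s - (1 / s) * (real N * v)" for s
    unfolding Nv[symmetric]
    by (simp only: Q0_def Let_def wj_def Wji_def g'_def W'_def m_def M_def)
  then show ?thesis
    using is_arg_max_neg_ln_minus_inverse[of "real N" v] \<open>0 < N\<close> \<open>0 < v\<close> by simp
qed

end
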